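(* Let $p$ be a prime and let $G=UT(4,p)$. Then $\operatorname{diam}(\Gamma_{\mathrm{red}}(G))=3$.
   Context: For a prime $p$, $UT(4,p)$ is the group, under matrix multiplication, of all $4\times 4$ upper triangular matrices over the finite field $\mathbb{F}_p$ with all diagonal entries equal to $1$. For a finite non-abelian group $G$, the commuting graph $\Gamma(G)$ has vertex set $G$, two distinct vertices $x,y$ being adjacent if and only if $xy=yx$. The reduced commuting graph $\Gamma_{\mathrm{red}}(G)$ is obtained from $\Gamma(G)$ by deleting the vertices in the center $Z(G)$ of $G$ (i.e. it is the induced subgraph on $G\setminus Z(G)$). The diameter $\operatorname{diam}$ of a connected graph is the maximum distance between two vertices. *)

theory Defs
  imports
    "HOL-Number_Theory.Residues"
    "Jordan_Normal_Form.Matrix"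
    "Graph_Theory.Graph_Theory"
begin

text \<open>Matrix indices run over \<open>0, \<dots>, n - 1\<close>.\<close>

definition UT :: "nat \<Rightarrow> ('a, 'b) ring_scheme \<Rightarrow> 'a mat monoid" where
  "UT n R = \<lparr>
     carrier = {A \<in> carrier_mat n n.
       (\<forall>i<n. \<forall>j<n. A $$ (i, j) \<in> carrier R) \<and>
       (\<forall>i<n. \<forall>j<i. A $$ (i, j) = \<zero>\<^bsub>R\<^esub>) \<and>
       (\<forall>i<n. A $$ (i, i) = \<one>\<^bsub>R\<^esub>)},
     monoid.mult = (\<lambda>A B. mat n n (\<lambda>(i, j). \<Oplus>\<^bsub>R\<^esub>k\<in>{..<n}. A $$ (i, k) \<otimes>\<^bsub>R\<^esub> B $$ (k, j))),
     one = mat n n (\<lambda>(i, j). if i = j then \<one>\<^bsub>R\<^esub> else \<zero>\<^bsub>R\<^esub>)\<rparr>"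

definition group_center :: "('a, 'b) monoid_scheme \<Rightarrow> 'a set" where
  "group_center G = {z \<in> carrier G. \<forall>g \<in> carrier G. z \<otimes>\<^bsub>G\<^esub> g = g \<otimes>\<^bsub>G\<^esub> z}"

text \<open>As in \<open>Graph_Theory\<close>, a simple graph is a loop-free symmetric digraph, so that each
  edge appears as a pair of opposite arcs.\<close>

definition commuting_graph :: "('a, 'b) monoid_scheme \<Rightarrow> 'a pair_pre_digraph" where
  "commuting_graph G = \<lparr>
     pverts = carrier G,
     parcs = {(x, y). x \<in> carrier G \<and> y \<in> carrier G \<and> x \<noteq> y \<and> x \<otimes>\<^bsub>G\<^esub> y = y \<otimes>\<^bsub>G\<^esub> x}\<rparr>"

definition reduced_commuting_graph :: "('a, 'b) monoid_scheme \<Rightarrow> ('a, 'a \<times> 'a) pre_digraph" where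
  "reduced_commuting_graph G =
     with_proj (commuting_graph G) \<restriction> (carrier G - group_center G)"

text \<open>With unit arc costs, the shortest-path cost is the graph distance, which is \<open>\<infinity>\<close> between
  vertices in different components. The diameter of a graph that is not connected but has
  vertices is therefore \<open>\<infinity>\<close>, and a finite diameter is a maximum.\<close>

definition graph_diameter :: "('a, 'b) pre_digraph \<Rightarrow> ereal" where
  "graph_diameter \<Gamma> = (SUP u\<in>verts \<Gamma>. SUP v\<in>verts \<Gamma>. wf_digraph.\<mu> \<Gamma> (\<lambda>_. 1) u v)"

lemma wf_commuting_graph: "wf_digraph (with_proj (commuting_graph G))"
  by unfold_locales (auto simp: commuting_graph_def)

lemma wf_reduced_commuting_graph: "wf_digraph (reduced_commuting_graph G)"
  unfolding reduced_commuting_graph_def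
  by (rule wf_digraph.wellformed_induce_subgraph[OF wf_commuting_graph])

end

theory Submission
  imports Defs
begin

text \<open>
  The argument works over any field. Write an upper unitriangular matrix of degree 4 with the
  entries \<open>a, b, c\<close> just above the diagonal, \<open>d, e\<close> above those, and \<open>f\<close> in the corner. Two
  such matrices commute iff
    \<open>a b' = a' b\<close>, \<open>b c' = b' c\<close> and \<open>a e' + d c' = a' e + d' c\<close>
  (\<open>unitri4_commute_iff\<close>), so the centre consists of the matrices in which only \<open>f\<close> may be
  nonzero (\<open>unitri4_central_iff\<close>).

  The diameter is at most 3 because the matrices with \<open>a = b = c = 0\<close> commute with one another
  and every matrix commutes with a noncentral one of them: commuting with such a matrix is the
  single homogeneous linear condition \<open>a e' = d' c\<close> on the two unknowns \<open>d', e'\<close>, which has a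
  nontrivial solution. Any two noncentral \<open>x\<close> and \<open>y\<close> are therefore joined by a walk
  \<open>x, z, w, y\<close> with \<open>z\<close> and \<open>w\<close> in this abelian subgroup, some of whose steps may be trivial.

  The diameter is at least 3 because two noncentral elements whose centralizers meet only in the
  centre have neither a common neighbour nor an edge between them (\<open>distance_ge_3\<close>). The
  matrices with \<open>(a, b, c) = (1, 1, 1)\<close> and \<open>(a, b, c) = (1, 0, 0)\<close> and no other entries above
  the diagonal are such a pair: commuting with the first forces \<open>a' = b' = c'\<close> and \<open>e' = d'\<close>,
  and commuting with the second then forces \<open>b' = 0\<close> and \<open>e' = 0\<close>.
\<close>

section \<open>Distances in the reduced commuting graph\<close>

lemma verts_reduced_commuting_graph:
  "verts (reduced_commuting_graph G) = carrier G - group_center G"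
  by (auto simp: reduced_commuting_graph_def)

lemma arcs_reduced_commuting_graph:
  "arcs (reduced_commuting_graph G) = {(x, y).
     x \<in> carrier G - group_center G \<and> y \<in> carrier G - group_center G \<and>
     x \<noteq> y \<and> x \<otimes>\<^bsub>G\<^esub> y = y \<otimes>\<^bsub>G\<^esub> x}"
  by (auto simp: reduced_commuting_graph_def commuting_graph_def)

lemma ends_reduced_commuting_graph:
  "tail (reduced_commuting_graph G) = fst" "head (reduced_commuting_graph G) = snd"
  by (simp_all add: reduced_commuting_graph_def)

text \<open>
  Equal elements count as commuting here and give the empty walk, so the vertices of a chain of
  commuting elements need not be checked for distinctness.
\<close>

lemma awalk_commuting_step:
  fixes G (structure)
  assumes "u \<in> carrier G - group_center G" "v \<in> carrier G - group_center G"
    and "u \<otimes> v = v \<otimes> u"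
  obtains p where "pre_digraph.awalk (reduced_commuting_graph G) u p v" "length p \<le> 1"
proof -
  interpret wf_digraph "reduced_commuting_graph G"
    by (rule wf_reduced_commuting_graph)
  show thesis
  proof (cases "u = v")
    case True
    then show ?thesis
      using assms that[of "[]"] by (simp add: awalk_Nil_iff verts_reduced_commuting_graph)
  next
    case False
    then show ?thesis
      using assms that[of "[(u, v)]"]
      by (simp add: awalk_def verts_reduced_commuting_graph arcs_reduced_commuting_graph
          ends_reduced_commuting_graph)
  qed
qed

lemma distance_le_3:
  fixes G (structure)
  assumes "u \<in> carrier G - group_center G" "z \<in> carrier G - group_center G"
    "w \<in> carrier G - group_center G" "v \<in> carrier G - group_center G"
    and "u \<otimes> z = z \<otimes> u" "z \<otimes> w = w \<otimes> z" "w \<otimes> v = v \<otimes> w"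
  shows "wf_digraph.\<mu> (reduced_commuting_graph G) (\<lambda>_. 1) u v \<le> 3"
proof -
  interpret wf_digraph "reduced_commuting_graph G"
    by (rule wf_reduced_commuting_graph)
  obtain p where p: "awalk u p z" "length p \<le> 1"
    using assms awalk_commuting_step by metis
  obtain q where q: "awalk z q w" "length q \<le> 1"
    using assms awalk_commuting_step by metis
  obtain r where r: "awalk w r v" "length r \<le> 1"
    using assms awalk_commuting_step by metis
  have "awalk u (p @ q @ r) v"
    using p q r by (auto intro: awalk_appendI)
  then have "\<mu> (\<lambda>_. 1) u v \<le> awalk_cost (\<lambda>_. 1) (p @ q @ r)"
    by (rule min_cost_le_walk_cost)
  also have "awalk_cost (\<lambda>_. 1) (p @ q @ r) \<le> 3"
    using p q r by (simp add: awalk_cost_def sum_list_triv)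
  finally show ?thesis by simp
qed

text \<open>
  On a walk of length at most 2 from \<open>u\<close> to \<open>v\<close> some vertex commutes with both ends: the middle
  vertex, or an end itself if the walk is shorter. The hypothesis makes that vertex central,
  whereas walks avoid the centre.
\<close>

lemma distance_ge_3:
  fixes G (structure)
  assumes u: "u \<in> carrier G - group_center G" and v: "v \<in> carrier G - group_center G"
    and meet: "\<And>g. g \<in> carrier G \<Longrightarrow> u \<otimes> g = g \<otimes> u \<Longrightarrow> g \<otimes> v = v \<otimes> g \<Longrightarrow> g \<in> group_center G"
  shows "3 \<le> wf_digraph.\<mu> (reduced_commuting_graph G) (\<lambda>_. 1) u v"
proof -
  interpret wf_digraph "reduced_commuting_graph G"
    by (rule wf_reduced_commuting_graph)
  have "3 \<le> ereal (awalk_cost (\<lambda>_. 1) p)" if p: "awalk u p v" for p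
  proof -
    have len: "3 \<le> length p"
    proof (rule ccontr)
      assume "\<not> 3 \<le> length p"
      then consider "p = []" | e where "p = [e]" | e e' where "p = [e, e']"
        by (cases p rule: list.exhaust)
          (auto simp: neq_Nil_conv not_le less_Suc_eq numeral_3_eq_3 length_Suc_conv)
      then show False
        using p u v meet
        by cases (auto simp: awalk_def verts_reduced_commuting_graph arcs_reduced_commuting_graph
          ends_reduced_commuting_graph)
    qed
    then show ?thesis
      by (simp add: awalk_cost_def sum_list_triv)
  qed
  then show ?thesis
    unfolding \<mu>_def by (intro INF_greatest) simp
qed

section \<open>Commutation in the unitriangular group of degree 4\<close>

text \<open>
  The parameters run along the superdiagonals, from the main one outwards to the corner, so
  that the first three are the coordinates of the abelianization and the last one is central.
\<close>

definition unitri4 :: "('a, 'b) ring_scheme \<Rightarrow> 'a \<Rightarrow> 'a \<Rightarrow> 'a \<Rightarrow> 'a \<Rightarrow> 'a \<Rightarrow> 'a \<Rightarrow> 'a mat" where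
  "unitri4 R a b c d e f = mat 4 4 (\<lambda>(i, j).
     [[\<one>\<^bsub>R\<^esub>, a, d, f],
      [\<zero>\<^bsub>R\<^esub>, \<one>\<^bsub>R\<^esub>, b, e],
      [\<zero>\<^bsub>R\<^esub>, \<zero>\<^bsub>R\<^esub>, \<one>\<^bsub>R\<^esub>, c],
      [\<zero>\<^bsub>R\<^esub>, \<zero>\<^bsub>R\<^esub>, \<zero>\<^bsub>R\<^esub>, \<one>\<^bsub>R\<^esub>]] ! i ! j)"

lemma all_less_2_3_4:
  fixes P :: "nat \<Rightarrow> bool"
  shows "(\<forall>i<2. P i) \<longleftrightarrow> P 0 \<and> P (Suc 0)"
    and "(\<forall>i<3. P i) \<longleftrightarrow> P 0 \<and> P (Suc 0) \<and> P 2"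
    and "(\<forall>i<4. P i) \<longleftrightarrow> P 0 \<and> P (Suc 0) \<and> P 2 \<and> P 3"
  by (auto simp: numeral_eq_Suc All_less_Suc)

lemma lessThan_4: "{..<4} = {0, Suc 0, 2, 3::nat}"
  by auto

lemma mat_4_eq_iff:
  assumes "A \<in> carrier_mat 4 4" "B \<in> carrier_mat 4 4"
  shows "A = B \<longleftrightarrow> (\<forall>i<4. \<forall>j<4. A $$ (i, j) = B $$ (i, j))"
  using assms by (auto intro!: eq_matI)

lemma unitri4_index:
  assumes "i < 4" "j < 4"
  shows "unitri4 R a b c d e f $$ (i, j) =
    [[\<one>\<^bsub>R\<^esub>, a, d, f],
      [\<zero>\<^bsub>R\<^esub>, \<one>\<^bsub>R\<^esub>, b, e],
      [\<zero>\<^bsub>R\<^esub>, \<zero>\<^bsub>R\<^esub>, \<one>\<^bsub>R\<^esub>, c],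
      [\<zero>\<^bsub>R\<^esub>, \<zero>\<^bsub>R\<^esub>, \<zero>\<^bsub>R\<^esub>, \<one>\<^bsub>R\<^esub>]] ! i ! j"
  using assms by (simp add: unitri4_def)

lemma unitri4_carrier_mat: "unitri4 R a b c d e f \<in> carrier_mat 4 4"
  by (simp add: unitri4_def)

lemma unitri4_eq_iff:
  "unitri4 R a b c d e f = unitri4 R a' b' c' d' e' f' \<longleftrightarrow>
     a = a' \<and> b = b' \<and> c = c' \<and> d = d' \<and> e = e' \<and> f = f'"
  by (auto simp: mat_4_eq_iff[OF unitri4_carrier_mat unitri4_carrier_mat] all_less_2_3_4
      unitri4_index)

context cring
begin

lemma carrier_UT4:
  "carrier (UT 4 R) = {unitri4 R a b c d e f | a b c d e f.
     a \<in> carrier R \<and> b \<in> carrier R \<and> c \<in> carrier R \<and>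
     d \<in> carrier R \<and> e \<in> carrier R \<and> f \<in> carrier R}" (is "_ = ?U")
proof
  show "carrier (UT 4 R) \<subseteq> ?U"
  proof
    fix A assume A: "A \<in> carrier (UT 4 R)"
    have eq: "A = unitri4 R (A $$ (0,1)) (A $$ (1,2)) (A $$ (2,3))
      (A $$ (0,2)) (A $$ (1,3)) (A $$ (0,3))"
      using A by (subst mat_4_eq_iff[OF _ unitri4_carrier_mat])
        (auto simp: UT_def all_less_2_3_4 unitri4_index)
    have "A $$ (i, j) \<in> carrier R" if "i < 4" "j < 4" for i j
      using A that by (auto simp: UT_def)
    then have "A $$ (0,1) \<in> carrier R" "A $$ (1,2) \<in> carrier R" "A $$ (2,3) \<in> carrier R"
      "A $$ (0,2) \<in> carrier R" "A $$ (1,3) \<in> carrier R" "A $$ (0,3) \<in> carrier R"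
      by simp_all
    with eq show "A \<in> ?U"
      by blast
  qed
  show "?U \<subseteq> carrier (UT 4 R)"
    by (auto simp: UT_def unitri4_carrier_mat unitri4_index all_less_2_3_4)
qed

lemma unitri4_in_UT4:
  assumes "a \<in> carrier R" "b \<in> carrier R" "c \<in> carrier R"
    "d \<in> carrier R" "e \<in> carrier R" "f \<in> carrier R"
  shows "unitri4 R a b c d e f \<in> carrier (UT 4 R)"
  using assms unfolding carrier_UT4 by blast

lemma UT4_cases:
  assumes "A \<in> carrier (UT 4 R)"
  obtains a b c d e f where "A = unitri4 R a b c d e f"
    "a \<in> carrier R" "b \<in> carrier R" "c \<in> carrier R"
    "d \<in> carrier R" "e \<in> carrier R" "f \<in> carrier R"
  using assms by (auto simp: carrier_UT4)

text \<open>
  The corner entry keeps \<open>a \<otimes> e' \<oplus> d \<otimes> c'\<close> bracketed, so that comparing the two products of a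
  pair of matrices amounts to cancelling the symmetric part \<open>f \<oplus> f'\<close>.
\<close>

lemma unitri4_mult:
  assumes [simp]: "a \<in> carrier R" "b \<in> carrier R" "c \<in> carrier R"
    "d \<in> carrier R" "e \<in> carrier R" "f \<in> carrier R"
    "a' \<in> carrier R" "b' \<in> carrier R" "c' \<in> carrier R"
    "d' \<in> carrier R" "e' \<in> carrier R" "f' \<in> carrier R"
  shows "unitri4 R a b c d e f \<otimes>\<^bsub>UT 4 R\<^esub> unitri4 R a' b' c' d' e' f' =
    unitri4 R (a \<oplus> a') (b \<oplus> b') (c \<oplus> c')
      (d \<oplus> d' \<oplus> a \<otimes> b') (e \<oplus> e' \<oplus> b \<otimes> c') (f \<oplus> f' \<oplus> (a \<otimes> e' \<oplus> d \<otimes> c'))"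
proof -
  have "unitri4 R a b c d e f \<otimes>\<^bsub>UT 4 R\<^esub> unitri4 R a' b' c' d' e' f' \<in> carrier_mat 4 4"
    by (simp add: UT_def)
  then show ?thesis
    apply (subst mat_4_eq_iff[OF _ unitri4_carrier_mat])
     apply (simp_all add: UT_def all_less_2_3_4)
    apply (simp add: unitri4_index lessThan_4 Pi_def)
    apply (simp add: a_ac)
    done
qed

lemma unitri4_commute_iff:
  assumes [simp]: "a \<in> carrier R" "b \<in> carrier R" "c \<in> carrier R"
    "d \<in> carrier R" "e \<in> carrier R" "f \<in> carrier R"
    "a' \<in> carrier R" "b' \<in> carrier R" "c' \<in> carrier R"
    "d' \<in> carrier R" "e' \<in> carrier R" "f' \<in> carrier R"
  shows "unitri4 R a b c d e f \<otimes>\<^bsub>UT 4 R\<^esub> unitri4 R a' b' c' d' e' f' =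
      unitri4 R a' b' c' d' e' f' \<otimes>\<^bsub>UT 4 R\<^esub> unitri4 R a b c d e f \<longleftrightarrow>
    a \<otimes> b' = a' \<otimes> b \<and> b \<otimes> c' = b' \<otimes> c \<and> a \<otimes> e' \<oplus> d \<otimes> c' = a' \<otimes> e \<oplus> d' \<otimes> c"
  by (simp add: unitri4_mult unitri4_eq_iff a_comm)

text \<open>
  Commuting with the three matrices that have a single one just above the diagonal already
  forces every entry except the corner to vanish.
\<close>

lemma unitri4_central_iff:
  assumes [simp]: "a \<in> carrier R" "b \<in> carrier R" "c \<in> carrier R"
    "d \<in> carrier R" "e \<in> carrier R" "f \<in> carrier R"
  shows "unitri4 R a b c d e f \<in> group_center (UT 4 R) \<longleftrightarrow>
    a = \<zero> \<and> b = \<zero> \<and> c = \<zero> \<and> d = \<zero> \<and> e = \<zero>"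
proof
  assume central: "unitri4 R a b c d e f \<in> group_center (UT 4 R)"
  have commute: "unitri4 R a b c d e f \<otimes>\<^bsub>UT 4 R\<^esub> unitri4 R a' b' c' \<zero> \<zero> \<zero> =
      unitri4 R a' b' c' \<zero> \<zero> \<zero> \<otimes>\<^bsub>UT 4 R\<^esub> unitri4 R a b c d e f"
    if "a' \<in> carrier R" "b' \<in> carrier R" "c' \<in> carrier R" for a' b' c'
    using central that by (simp add: group_center_def unitri4_in_UT4)
  show "a = \<zero> \<and> b = \<zero> \<and> c = \<zero> \<and> d = \<zero> \<and> e = \<zero>"
    using commute[of \<one> \<zero> \<zero>] commute[of \<zero> \<one> \<zero>] commute[of \<zero> \<zero> \<one>]
    by (auto simp: unitri4_commute_iff)
next
  assume "a = \<zero> \<and> b = \<zero> \<and> c = \<zero> \<and> d = \<zero> \<and> e = \<zero>"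
  then show "unitri4 R a b c d e f \<in> group_center (UT 4 R)"
    by (auto simp: group_center_def unitri4_in_UT4 unitri4_commute_iff elim!: UT4_cases)
qed

end

section \<open>The diameter\<close>

context field
begin

text \<open>
  The condition to solve is \<open>a \<otimes> e' = d' \<otimes> c\<close>. The solution \<open>(d', e') = (a, c)\<close> is
  nontrivial unless \<open>a = c = \<zero>\<close>, and then any nonzero
  \<open>(d', e')\<close> will do.
\<close>

lemma UT4_commutes_with_noncentral_abelian:
  assumes "A \<in> carrier (UT 4 R)"
  obtains d e where "d \<in> carrier R" "e \<in> carrier R"
    "unitri4 R \<zero> \<zero> \<zero> d e \<zero> \<in> carrier (UT 4 R) - group_center (UT 4 R)"
    "A \<otimes>\<^bsub>UT 4 R\<^esub> unitri4 R \<zero> \<zero> \<zero> d e \<zero> = unitri4 R \<zero> \<zero> \<zero> d e \<zero> \<otimes>\<^bsub>UT 4 R\<^esub> A"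
proof -
  obtain a b c d e f where A: "A = unitri4 R a b c d e f"
    and [simp]: "a \<in> carrier R" "b \<in> carrier R" "c \<in> carrier R"
      "d \<in> carrier R" "e \<in> carrier R" "f \<in> carrier R"
    using assms by (rule UT4_cases)
  show thesis
  proof (cases "a = \<zero> \<and> c = \<zero>")
    case True
    then show ?thesis
      by (intro that[of \<one> \<zero>])
        (auto simp: A unitri4_in_UT4 unitri4_commute_iff unitri4_central_iff)
  next
    case False
    then show ?thesis
      by (intro that[of a c])
        (auto simp: A unitri4_in_UT4 unitri4_commute_iff unitri4_central_iff)
  qed
qed

lemma UT4_distance_le_3:
  assumes A: "A \<in> carrier (UT 4 R) - group_center (UT 4 R)"
    and B: "B \<in> carrier (UT 4 R) - group_center (UT 4 R)"
  shows "wf_digraph.\<mu> (reduced_commuting_graph (UT 4 R)) (\<lambda>_. 1) A B \<le> 3"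
proof -
  from A obtain d e where Z [simp]: "d \<in> carrier R" "e \<in> carrier R"
    "unitri4 R \<zero> \<zero> \<zero> d e \<zero> \<in> carrier (UT 4 R) - group_center (UT 4 R)"
    "A \<otimes>\<^bsub>UT 4 R\<^esub> unitri4 R \<zero> \<zero> \<zero> d e \<zero> = unitri4 R \<zero> \<zero> \<zero> d e \<zero> \<otimes>\<^bsub>UT 4 R\<^esub> A"
    by (auto elim: UT4_commutes_with_noncentral_abelian)
  from B obtain d' e' where W [simp]: "d' \<in> carrier R" "e' \<in> carrier R"
    "unitri4 R \<zero> \<zero> \<zero> d' e' \<zero> \<in> carrier (UT 4 R) - group_center (UT 4 R)"
    "B \<otimes>\<^bsub>UT 4 R\<^esub> unitri4 R \<zero> \<zero> \<zero> d' e' \<zero> = unitri4 R \<zero> \<zero> \<zero> d' e' \<zero> \<otimes>\<^bsub>UT 4 R\<^esub> B"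
    by (auto elim: UT4_commutes_with_noncentral_abelian)
  have "unitri4 R \<zero> \<zero> \<zero> d e \<zero> \<otimes>\<^bsub>UT 4 R\<^esub> unitri4 R \<zero> \<zero> \<zero> d' e' \<zero> =
      unitri4 R \<zero> \<zero> \<zero> d' e' \<zero> \<otimes>\<^bsub>UT 4 R\<^esub> unitri4 R \<zero> \<zero> \<zero> d e \<zero>"
    by (simp add: unitri4_commute_iff)
  then show ?thesis
    by (rule distance_le_3[OF A Z(3) W(3) B Z(4) _ W(4)[symmetric]])
qed

text \<open>
  A matrix that commutes with the first one below has the shape \<open>(t, t, t, s, s, f)\<close>. The second
  one is chosen with \<open>b = \<zero> \<noteq> a\<close>, so that \<open>t = \<zero>\<close>, and with \<open>a \<noteq> c\<close>, so that then \<open>s = \<zero>\<close>.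
\<close>

lemma UT4_exists_distance_ge_3:
  obtains A B where "A \<in> carrier (UT 4 R) - group_center (UT 4 R)"
    "B \<in> carrier (UT 4 R) - group_center (UT 4 R)"
    "3 \<le> wf_digraph.\<mu> (reduced_commuting_graph (UT 4 R)) (\<lambda>_. 1) A B"
proof -
  let ?A = "unitri4 R \<one> \<one> \<one> \<zero> \<zero> \<zero>" and ?B = "unitri4 R \<one> \<zero> \<zero> \<zero> \<zero> \<zero>"
  have A: "?A \<in> carrier (UT 4 R) - group_center (UT 4 R)"
    and B: "?B \<in> carrier (UT 4 R) - group_center (UT 4 R)"
    by (simp_all add: unitri4_in_UT4 unitri4_central_iff)
  have "g \<in> group_center (UT 4 R)" if g: "g \<in> carrier (UT 4 R)"
    "?A \<otimes>\<^bsub>UT 4 R\<^esub> g = g \<otimes>\<^bsub>UT 4 R\<^esub> ?A" "g \<otimes>\<^bsub>UT 4 R\<^esub> ?B = ?B \<otimes>\<^bsub>UT 4 R\<^esub> g" for g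
    using g by (auto elim!: UT4_cases simp: unitri4_commute_iff unitri4_central_iff)
  then show thesis
    using that A B distance_ge_3[OF A B] by blast
qed

theorem graph_diameter_UT4: "graph_diameter (reduced_commuting_graph (UT 4 R)) = 3"
proof (rule antisym)
  show "graph_diameter (reduced_commuting_graph (UT 4 R)) \<le> 3"
    unfolding graph_diameter_def verts_reduced_commuting_graph
    by (intro SUP_least UT4_distance_le_3)
  obtain A B where "A \<in> carrier (UT 4 R) - group_center (UT 4 R)"
    "B \<in> carrier (UT 4 R) - group_center (UT 4 R)"
    "3 \<le> wf_digraph.\<mu> (reduced_commuting_graph (UT 4 R)) (\<lambda>_. 1) A B"
    by (rule UT4_exists_distance_ge_3)
  then show "3 \<le> graph_diameter (reduced_commuting_graph (UT 4 R))"
    unfolding graph_diameter_def verts_reduced_commuting_graph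
    by (blast intro: SUP_upper2)
qed

end

theorem theorem3p3:
  fixes p :: nat
  assumes "prime p"
  shows "graph_diameter (reduced_commuting_graph (UT 4 (residue_ring (int p)))) = 3"
proof -
  interpret residues_prime p "residue_ring (int p)"
    using assms by unfold_locales simp_all
  show ?thesis
    using is_field by (rule field.graph_diameter_UT4)
qed

end
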